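(* Let $(A,\cdot)$ be a left-symmetric algebra and let $r=\sum_i a_i\otimes b_i\in A\otimes A$ be symmetric. Suppose that $r$ satisfies the $S$-equation $$-r_{12}\cdot r_{13}+r_{12}\cdot r_{23}+[r_{13},r_{23}]=0,$$ that is, $$\sum_{i,j}\big(-a_i\cdot a_j\otimes b_i\otimes b_j+a_i\otimes b_i\cdot a_j\otimes b_j+a_i\otimes a_j\otimes[b_i,b_j]\big)=0\quad\text{in }A\otimes A\otimes A.$$ Then the map $\alpha:A\to A\otimes A$, $\alpha(x)=(L_x\otimes1+1\otimes\mathrm{ad}\,x)r$, induces (via its dual map $\alpha^*:A^*\otimes A^*\to A^*$) a left-symmetric algebra structure on $A^*$ such that $(A,A^* )$ is a left-symmetric bialgebra.
   Context: All algebras are finite-dimensional over a field $\mathbf F$. A left-symmetric algebra is a vector space $A$ with a bilinear product satisfying $(xy)z-x(yz)=(yx)z-y(xz)$. Its sub-adjacent Lie algebra $\mathcal G(A)$ is $A$ with $[x,y]=xy-yx$. Write $L_xy=xy$, $R_xy=yx$, $\mathrm{ad}\,x=L_x-R_x$. An element $r=\sum_i a_i\otimes b_i$ is symmetric if $\sum_i a_i\otimes b_i=\sum_i b_i\otimes a_i$. Left-symmetric bialgebra $(A,A^* )$: left-symmetric products on $A$ and on its dual $A^*$ such that, if $\alpha:A\to A\otimes A$ is the dual map of the product $A^*\otimes A^*\to A^*$ and $\beta:A^*\to A^*\otimes A^*$ is the dual map of the product $A\otimes A\to A$, then $\alpha$ is a 1-cocycle of $\mathcal G(A)$ associated to the representation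 $L\otimes1+1\otimes\mathrm{ad}$ on $A\otimes A$, and $\beta$ is a 1-cocycle of $\mathcal G(A^* )$ associated to $L\otimes1+1\otimes\mathrm{ad}$ on $A^*\otimes A^*$. A 1-cocycle $\delta$ associated to a representation $\rho$ satisfies $\delta([x,y])=\rho(x)\delta(y)-\rho(y)\delta(x)$. *)

theory Defs
  imports Complex_Main "HOL-Library.Function_Algebras"
begin

section \<open>Vector spaces of functions, multilinear maps, dual space\<close>

text \<open>
  Vector spaces occur as subspaces \<open>V\<close> of a type \<open>'v\<close> that carries a vector space structure
  \<open>scale\<close> over the field \<open>'k\<close>. Linearity conditions on maps are only imposed on \<open>V\<close>.
  Addition of functions is pointwise addition.
\<close>

definition fscale :: "'k::field \<Rightarrow> ('x \<Rightarrow> 'k) \<Rightarrow> 'x \<Rightarrow> 'k" where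
  "fscale c f = (\<lambda>x. c * f x)"

definition linear_on :: "('k \<Rightarrow> 'v \<Rightarrow> 'v) \<Rightarrow> 'v set \<Rightarrow> ('k \<Rightarrow> 'w \<Rightarrow> 'w) \<Rightarrow> ('v::plus \<Rightarrow> 'w::plus) \<Rightarrow> bool"
  where "linear_on s V s' f \<longleftrightarrow>
    (\<forall>u\<in>V. \<forall>v\<in>V. f (u + v) = f u + f v) \<and> (\<forall>c. \<forall>v\<in>V. f (s c v) = s' c (f v))"

definition bilinear_on ::
  "('k \<Rightarrow> 'v \<Rightarrow> 'v) \<Rightarrow> 'v set \<Rightarrow> ('k \<Rightarrow> 'w \<Rightarrow> 'w) \<Rightarrow> ('v::plus \<Rightarrow> 'v \<Rightarrow> 'w::plus) \<Rightarrow> bool"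
  where "bilinear_on s V s' f \<longleftrightarrow>
    (\<forall>u\<in>V. linear_on s V s' (\<lambda>v. f u v)) \<and> (\<forall>v\<in>V. linear_on s V s' (\<lambda>u. f u v))"

definition trilinear_on ::
  "('k \<Rightarrow> 'v \<Rightarrow> 'v) \<Rightarrow> 'v set \<Rightarrow> ('k \<Rightarrow> 'w \<Rightarrow> 'w) \<Rightarrow> ('v::plus \<Rightarrow> 'v \<Rightarrow> 'v \<Rightarrow> 'w::plus) \<Rightarrow> bool"
  where "trilinear_on s V s' f \<longleftrightarrow>
    (\<forall>u\<in>V. \<forall>v\<in>V. linear_on s V s' (\<lambda>w. f u v w)) \<and>
    (\<forall>u\<in>V. \<forall>w\<in>V. linear_on s V s' (\<lambda>v. f u v w)) \<and>
    (\<forall>v\<in>V. \<forall>w\<in>V. linear_on s V s' (\<lambda>u. f u v w))"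

definition dual :: "('k::field \<Rightarrow> 'v::ab_group_add \<Rightarrow> 'v) \<Rightarrow> ('v \<Rightarrow> 'k) set" where
  "dual scale = {f. Vector_Spaces.linear scale (*) f}"


section \<open>Tensor products\<close>

text \<open>
  \<open>V \<otimes> V\<close> is realised inside the space of functionals on bilinear forms: \<open>u \<otimes> v\<close> is the
  evaluation \<open>B \<mapsto> B u v\<close>, and \<open>V \<otimes> V\<close> is the span of these. The value 0 at functions that
  are not bilinear forms on \<open>V\<close> makes equality of tensors equality of functions. Similarly for
  \<open>V \<otimes> V \<otimes> V\<close> and trilinear forms. The universal properties are proved below.
\<close>

definition tensor2 :: "('k::field \<Rightarrow> 'v \<Rightarrow> 'v) \<Rightarrow> 'v set \<Rightarrow> 'v::ab_group_add \<Rightarrow> 'v \<Rightarrow>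
    ('v \<Rightarrow> 'v \<Rightarrow> 'k) \<Rightarrow> 'k" where
  "tensor2 s V u v = (\<lambda>B. if bilinear_on s V (*) B then B u v else 0)"

definition tensor3 :: "('k::field \<Rightarrow> 'v \<Rightarrow> 'v) \<Rightarrow> 'v set \<Rightarrow> 'v::ab_group_add \<Rightarrow> 'v \<Rightarrow> 'v \<Rightarrow>
    ('v \<Rightarrow> 'v \<Rightarrow> 'v \<Rightarrow> 'k) \<Rightarrow> 'k" where
  "tensor3 s V u v w = (\<lambda>B. if trilinear_on s V (*) B then B u v w else 0)"

definition tensor2_space :: "('k::field \<Rightarrow> 'v \<Rightarrow> 'v) \<Rightarrow> 'v::ab_group_add set \<Rightarrow>
    (('v \<Rightarrow> 'v \<Rightarrow> 'k) \<Rightarrow> 'k) set" where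
  "tensor2_space s V = module.span fscale {tensor2 s V u v | u v. u \<in> V \<and> v \<in> V}"

text \<open>The map \<open>T \<otimes> S\<close> on \<open>V \<otimes> V\<close>, for linear \<open>T, S : V \<rightarrow> V\<close>; see \<open>tensor2_map_tensor2\<close>.\<close>

definition tensor2_map :: "('k::field \<Rightarrow> 'v \<Rightarrow> 'v) \<Rightarrow> 'v set \<Rightarrow> ('v::ab_group_add \<Rightarrow> 'v) \<Rightarrow> ('v \<Rightarrow> 'v) \<Rightarrow>
    (('v \<Rightarrow> 'v \<Rightarrow> 'k) \<Rightarrow> 'k) \<Rightarrow> ('v \<Rightarrow> 'v \<Rightarrow> 'k) \<Rightarrow> 'k" where
  "tensor2_map s V T S t = (\<lambda>B. if bilinear_on s V (*) B then t (\<lambda>u v. B (T u) (S v)) else 0)"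

text \<open>
  The pairing of \<open>A\<^sup>* \<otimes> A\<^sup>*\<close> with \<open>A \<otimes> A\<close>, determined by
  \<open>\<langle>f \<otimes> g, u \<otimes> v\<rangle> = f u * g v\<close>; see \<open>tensor_pairing_tensor2\<close>.
\<close>

definition tensor_pairing ::
  "((('v \<Rightarrow> 'k) \<Rightarrow> ('v \<Rightarrow> 'k) \<Rightarrow> 'k) \<Rightarrow> 'k) \<Rightarrow> (('v \<Rightarrow> 'v \<Rightarrow> 'k) \<Rightarrow> 'k) \<Rightarrow> 'k::field" where
  "tensor_pairing \<tau> t = \<tau> (\<lambda>f g. t (\<lambda>u v. f u * g v))"


section \<open>Left-symmetric algebras and bialgebras\<close>

locale left_symmetric_algebra = vector_space scale
  for scale :: "'k::field \<Rightarrow> 'v::ab_group_add \<Rightarrow> 'v" +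
  fixes V :: "'v set" and mult :: "'v \<Rightarrow> 'v \<Rightarrow> 'v"
  assumes subspace: "subspace V"
    and finite_dim: "\<exists>B. finite B \<and> span B = V"
    and mult_closed: "x \<in> V \<Longrightarrow> y \<in> V \<Longrightarrow> mult x y \<in> V"
    and mult_bilinear: "bilinear_on scale V scale mult"
    and left_symmetric: "x \<in> V \<Longrightarrow> y \<in> V \<Longrightarrow> z \<in> V \<Longrightarrow>
      mult (mult x y) z - mult x (mult y z) = mult (mult y x) z - mult y (mult x z)"

definition commutator :: "('v::ab_group_add \<Rightarrow> 'v \<Rightarrow> 'v) \<Rightarrow> 'v \<Rightarrow> 'v \<Rightarrow> 'v" where
  "commutator mult x y = mult x y - mult y x"

text \<open>The representation \<open>L \<otimes> 1 + 1 \<otimes> ad\<close> of the sub-adjacent Lie algebra on \<open>V \<otimes> V\<close>.\<close>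

definition L_ad :: "('k::field \<Rightarrow> 'v \<Rightarrow> 'v) \<Rightarrow> 'v set \<Rightarrow> ('v::ab_group_add \<Rightarrow> 'v \<Rightarrow> 'v) \<Rightarrow>
    'v \<Rightarrow> (('v \<Rightarrow> 'v \<Rightarrow> 'k) \<Rightarrow> 'k) \<Rightarrow> ('v \<Rightarrow> 'v \<Rightarrow> 'k) \<Rightarrow> 'k" where
  "L_ad s V mult x t =
    tensor2_map s V (mult x) (\<lambda>v. v) t + tensor2_map s V (\<lambda>u. u) (commutator mult x) t"

text \<open>
  1-cocycles \<open>\<delta> : V \<rightarrow> W\<close> of the Lie algebra \<open>V\<close> with the given bracket, for a representation \<open>\<rho>\<close>
  of \<open>V\<close> on \<open>W\<close>.
\<close>

definition one_cocycle :: "('k \<Rightarrow> 'v \<Rightarrow> 'v) \<Rightarrow> 'v set \<Rightarrow> ('v \<Rightarrow> 'v \<Rightarrow> 'v) \<Rightarrow>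
    ('k \<Rightarrow> 'w \<Rightarrow> 'w) \<Rightarrow> 'w set \<Rightarrow> ('v \<Rightarrow> 'w \<Rightarrow> 'w) \<Rightarrow> ('v::ab_group_add \<Rightarrow> 'w::ab_group_add) \<Rightarrow> bool"
  where "one_cocycle s V br s' W \<rho> \<delta> \<longleftrightarrow>
    \<delta> ` V \<subseteq> W \<and> linear_on s V s' \<delta> \<and>
    (\<forall>x\<in>V. \<forall>y\<in>V. \<delta> (br x y) = \<rho> x (\<delta> y) - \<rho> y (\<delta> x))"

text \<open>
  The products \<open>mult\<close> on \<open>A\<close> (the whole type) and \<open>mult'\<close> on \<open>A\<^sup>*\<close> form a left-symmetric
  bialgebra. Here \<open>\<alpha> : A \<rightarrow> A \<otimes> A\<close> is the dual map of \<open>mult'\<close>, and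
  \<open>\<beta> : A\<^sup>* \<rightarrow> A\<^sup>* \<otimes> A\<^sup>*\<close> is the dual map of \<open>mult\<close>; as \<open>A\<close> is finite-dimensional, these are
  uniquely determined by the stated duality equations.
\<close>

definition left_symmetric_bialgebra :: "('k::field \<Rightarrow> 'a::ab_group_add \<Rightarrow> 'a) \<Rightarrow>
    ('a \<Rightarrow> 'a \<Rightarrow> 'a) \<Rightarrow> (('a \<Rightarrow> 'k) \<Rightarrow> ('a \<Rightarrow> 'k) \<Rightarrow> ('a \<Rightarrow> 'k)) \<Rightarrow> bool" where
  "left_symmetric_bialgebra scale mult mult' \<longleftrightarrow>
    left_symmetric_algebra scale UNIV mult \<and>
    left_symmetric_algebra fscale (dual scale) mult' \<and>
    (\<exists>\<alpha>. (\<forall>f\<in>dual scale. \<forall>g\<in>dual scale. \<forall>x.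
            tensor_pairing (tensor2 fscale (dual scale) f g) (\<alpha> x) = mult' f g x) \<and>
         one_cocycle scale UNIV (commutator mult) fscale (tensor2_space scale UNIV)
           (L_ad scale UNIV mult) \<alpha>) \<and>
    (\<exists>\<beta>. (\<forall>f\<in>dual scale. \<forall>x y.
            tensor_pairing (\<beta> f) (tensor2 scale UNIV x y) = f (mult x y)) \<and>
         one_cocycle fscale (dual scale) (commutator mult') fscale (tensor2_space fscale (dual scale))
           (L_ad fscale (dual scale) mult') \<beta>)"

text \<open>
  The dual map \<open>\<alpha>\<^sup>* : A\<^sup>* \<otimes> A\<^sup>* \<rightarrow> A\<^sup>*\<close> of \<open>\<alpha> : A \<rightarrow> A \<otimes> A\<close>, and the product on \<open>A\<^sup>*\<close> that
  it induces.
\<close>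

definition dual_map :: "('a \<Rightarrow> ('a \<Rightarrow> 'a \<Rightarrow> 'k) \<Rightarrow> 'k) \<Rightarrow>
    ((('a \<Rightarrow> 'k) \<Rightarrow> ('a \<Rightarrow> 'k) \<Rightarrow> 'k) \<Rightarrow> 'k) \<Rightarrow> 'a \<Rightarrow> 'k::field" where
  "dual_map \<alpha> \<tau> = (\<lambda>x. tensor_pairing \<tau> (\<alpha> x))"

definition dual_product :: "('k::field \<Rightarrow> 'a::ab_group_add \<Rightarrow> 'a) \<Rightarrow> ('a \<Rightarrow> ('a \<Rightarrow> 'a \<Rightarrow> 'k) \<Rightarrow> 'k) \<Rightarrow>
    ('a \<Rightarrow> 'k) \<Rightarrow> ('a \<Rightarrow> 'k) \<Rightarrow> 'a \<Rightarrow> 'k" where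
  "dual_product scale \<alpha> f g = dual_map \<alpha> (tensor2 fscale (dual scale) f g)"

text \<open>
  The \<open>S\<close>-equation \<open>- r\<^sub>1\<^sub>2 \<cdot> r\<^sub>1\<^sub>3 + r\<^sub>1\<^sub>2 \<cdot> r\<^sub>2\<^sub>3 + [r\<^sub>1\<^sub>3, r\<^sub>2\<^sub>3] = 0\<close> for \<open>r = (\<Sum>i\<in>I. a i \<otimes> b i)\<close>.
\<close>

definition S_equation :: "('k::field \<Rightarrow> 'v \<Rightarrow> 'v) \<Rightarrow> 'v set \<Rightarrow> ('v::ab_group_add \<Rightarrow> 'v \<Rightarrow> 'v) \<Rightarrow>
    'i set \<Rightarrow> ('i \<Rightarrow> 'v) \<Rightarrow> ('i \<Rightarrow> 'v) \<Rightarrow> bool" where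
  "S_equation s V mult I a b \<longleftrightarrow>
    (\<Sum>i\<in>I. \<Sum>j\<in>I.
        - tensor3 s V (mult (a i) (a j)) (b i) (b j)
        + tensor3 s V (a i) (mult (b i) (a j)) (b j)
        + tensor3 s V (a i) (a j) (commutator mult (b i) (b j))) = 0"


section \<open>Basic properties of the constructions\<close>

lemma vector_space_fscale: "vector_space fscale"
  by unfold_locales (auto simp: fscale_def fun_eq_iff algebra_simps)

lemma vector_space_mult: "vector_space ((*) :: 'k::field \<Rightarrow> 'k \<Rightarrow> 'k)"
  by unfold_locales (auto simp: algebra_simps)

lemma sum_apply: "(\<Sum>i\<in>I. f i) x = (\<Sum>i\<in>I. f i x)"
  for f :: "'i \<Rightarrow> 'x \<Rightarrow> 'k::field"
  by (induction I rule: infinite_finite_induct) auto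

lemma subspace_dual:
  assumes "vector_space scale"
  shows "module.subspace fscale (dual scale)"
proof -
  interpret F: vector_space fscale by (rule vector_space_fscale)
  show ?thesis
    using assms vector_space_mult
    by (auto simp: F.subspace_def dual_def Vector_Spaces.linear_iff fscale_def algebra_simps)
qed

lemma sum_reindex_if:
  fixes S :: "'k::zero \<Rightarrow> 'd \<Rightarrow> 'd::ab_group_add"
  assumes "finite K" "i ` t \<subseteq> K" "inj_on i t" "\<And>x. S 0 x = 0" "\<And>b. b \<in> t \<Longrightarrow> e (i b) = b"
  shows "(\<Sum>k\<in>K. S (if k \<in> i ` t then c (e k) else 0) (F k)) = (\<Sum>b\<in>t. S (c b) (F (i b)))"
proof -
  have "(\<Sum>k\<in>K. S (if k \<in> i ` t then c (e k) else 0) (F k)) = (\<Sum>k\<in>i ` t. S (c (e k)) (F k))"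
    using assms by (intro sum.mono_neutral_cong_right) auto
  also have "\<dots> = (\<Sum>b\<in>t. S (c b) (F (i b)))"
    using assms by (subst sum.reindex) (auto intro!: sum.cong)
  finally show ?thesis .
qed

lemma linear_extension:
  assumes s: "vector_space s" and s': "vector_space s'"
    and wd: "\<And>K c. finite K \<Longrightarrow> K \<subseteq> J \<Longrightarrow> (\<Sum>j\<in>K. s (c j) (e j)) = 0 \<Longrightarrow> (\<Sum>j\<in>K. s' (c j) (f j)) = 0"
  shows "\<exists>h. Vector_Spaces.linear s s' h \<and> (\<forall>j\<in>J. h (e j) = f j)"
proof -
  interpret P: vector_space_pair s s' using s s' by (rule vector_space_pair.intro)
  obtain B where B: "B \<subseteq> e ` J" "P.vs1.independent B" "e ` J \<subseteq> P.vs1.span B"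
    by (rule P.vs1.maximal_independent_subset)
  define i where "i = inv_into J e"
  have i: "i b \<in> J" "e (i b) = b" if "b \<in> B" for b
    using that B(1) by (auto simp: i_def f_inv_into_f inv_into_into subset_iff)
  obtain h where h: "Vector_Spaces.linear s s' h" "\<forall>b\<in>B. h b = f (i b)"
    using P.linear_independent_extend[OF B(2), of "\<lambda>b. f (i b)"] by auto
  interpret h: Vector_Spaces.linear s s' h by (rule h(1))
  have "h (e j) = f j" if j: "j \<in> J" for j
  proof -
    obtain t c where t: "finite t" "t \<subseteq> B" "e j = (\<Sum>b\<in>t. s (c b) b)"
      using B(3) j unfolding P.vs1.span_explicit by blast
    have injt: "inj_on i t" using i(2) t(2) by (metis inj_on_def subsetD)
    have *: "h (e j) = (\<Sum>b\<in>t. s' (c b) (f (i b)))"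
      using h(2) t(2) by (auto simp: t(3) h.sum h.scale subset_iff intro!: sum.cong)
    define K where "K = insert j (i ` t)"
    define d where "d k = (if k \<in> i ` t then c (e k) else 0) - (if k = j then 1 else 0)" for k
    have fK: "finite K" "K \<subseteq> J" using t i(1) j by (auto simp: K_def)
    have r: "(\<Sum>k\<in>K. s (if k \<in> i ` t then c (e k) else 0) (e k)) = (\<Sum>b\<in>t. s (c b) (e (i b)))"
      using sum_reindex_if[OF fK(1) _ injt, where S = s and c = c and e = e and F = e] t(2) i(2) by (auto simp: K_def subset_iff)
    have r': "(\<Sum>k\<in>K. s' (if k \<in> i ` t then c (e k) else 0) (f k)) = (\<Sum>b\<in>t. s' (c b) (f (i b)))"
      using sum_reindex_if[OF fK(1) _ injt, where S = s' and c = c and e = e and F = f] t(2) i(2) by (auto simp: K_def subset_iff)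
    have r1: "(\<Sum>k\<in>K. s (d k) (e k)) = 0"
    proof -
      have "(\<Sum>k\<in>K. s (d k) (e k)) =
          (\<Sum>b\<in>t. s (c b) (e (i b))) - (\<Sum>k\<in>K. s (if k = j then 1 else 0) (e k))"
        unfolding d_def P.vs1.scale_left_diff_distrib sum_subtractf
        using r by simp
      also have "(\<Sum>k\<in>K. s (if k = j then 1 else 0) (e k)) = e j"
        using fK(1) by (simp add: if_distrib[of "\<lambda>x. s x _"] K_def cong: if_cong)
      also have "(\<Sum>b\<in>t. s (c b) (e (i b))) = e j"
        using t i(2) by (auto intro!: sum.cong simp: subset_iff)
      finally show ?thesis by simp
    qed
    have "0 = (\<Sum>k\<in>K. s' (d k) (f k))" using wd[OF fK r1] by simp
    also have "\<dots> =
          (\<Sum>b\<in>t. s' (c b) (f (i b))) - (\<Sum>k\<in>K. s' (if k = j then 1 else 0) (f k))"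
      unfolding d_def P.vs2.scale_left_diff_distrib sum_subtractf
      using r' by simp
    also have "(\<Sum>k\<in>K. s' (if k = j then 1 else 0) (f k)) = f j"
      using fK(1) by (simp add: if_distrib[of "\<lambda>x. s' x _"] K_def cong: if_cong)
    finally show ?thesis using * by simp
  qed
  with h(1) show ?thesis by auto
qed

lemma functionals_separate:
  assumes s: "vector_space s" and z: "\<And>p. Vector_Spaces.linear s (*) p \<Longrightarrow> p z = 0"
  shows "z = 0"
proof (rule ccontr)
  assume nz: "z \<noteq> 0"
  interpret P: vector_space_pair s "(*)" using s vector_space_mult by (rule vector_space_pair.intro)
  have "P.vs1.independent {z}" using nz by simp
  from P.linear_independent_extend[OF this, of "\<lambda>_. 1"]
  obtain p where "Vector_Spaces.linear s (*) p" "p z = 1" by auto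
  with z show False by fastforce
qed

lemma tensor2_bilinear:
  "bilinear_on s V fscale (tensor2 s V)"
  unfolding bilinear_on_def linear_on_def
  by (auto simp: tensor2_def fscale_def fun_eq_iff) (auto simp: bilinear_on_def linear_on_def)

lemma tensor3_trilinear:
  "trilinear_on s V fscale (tensor3 s V)"
  unfolding trilinear_on_def linear_on_def
  by (auto simp: tensor3_def fscale_def fun_eq_iff) (auto simp: trilinear_on_def linear_on_def)

theorem tensor2_universal:
  assumes s': "vector_space s'" and f: "bilinear_on s V s' f"
  shows "\<exists>h. Vector_Spaces.linear fscale s' h \<and> (\<forall>u\<in>V. \<forall>v\<in>V. h (tensor2 s V u v) = f u v)"
proof -
  have "\<exists>h. Vector_Spaces.linear fscale s' h \<and>
      (\<forall>j\<in>V \<times> V. h (tensor2 s V (fst j) (snd j)) = f (fst j) (snd j))"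
  proof (rule linear_extension[OF vector_space_fscale s'])
    fix K c assume K: "finite K" "K \<subseteq> V \<times> V"
      "(\<Sum>j\<in>K. fscale (c j) (tensor2 s V (fst j) (snd j))) = 0"
    show "(\<Sum>j\<in>K. s' (c j) (f (fst j) (snd j))) = 0"
    proof (rule functionals_separate[OF s'])
      fix p assume p: "Vector_Spaces.linear s' (*) p"
      interpret p: Vector_Spaces.linear s' "(*)" p by (rule p)
      define B where "B u v = p (f u v)" for u v
      have "bilinear_on s V (*) B"
        using f by (auto simp: bilinear_on_def linear_on_def B_def p.add p.scale)
      with fun_cong[OF K(3), of B] have "(\<Sum>j\<in>K. c j * B (fst j) (snd j)) = 0"
        by (simp add: sum_apply fscale_def tensor2_def)
      then show "p (\<Sum>j\<in>K. s' (c j) (f (fst j) (snd j))) = 0"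
        by (simp add: p.sum p.scale B_def)
    qed
  qed
  then show ?thesis by auto
qed

theorem tensor3_universal:
  assumes s': "vector_space s'" and f: "trilinear_on s V s' f"
  shows "\<exists>h. Vector_Spaces.linear fscale s' h \<and>
    (\<forall>u\<in>V. \<forall>v\<in>V. \<forall>w\<in>V. h (tensor3 s V u v w) = f u v w)"
proof -
  have "\<exists>h. Vector_Spaces.linear fscale s' h \<and> (\<forall>j\<in>V \<times> V \<times> V.
      h (tensor3 s V (fst j) (fst (snd j)) (snd (snd j))) = f (fst j) (fst (snd j)) (snd (snd j)))"
  proof (rule linear_extension[OF vector_space_fscale s'])
    fix K c assume K: "finite K" "K \<subseteq> V \<times> V \<times> V"
      "(\<Sum>j\<in>K. fscale (c j) (tensor3 s V (fst j) (fst (snd j)) (snd (snd j)))) = 0"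
    show "(\<Sum>j\<in>K. s' (c j) (f (fst j) (fst (snd j)) (snd (snd j)))) = 0"
    proof (rule functionals_separate[OF s'])
      fix p assume p: "Vector_Spaces.linear s' (*) p"
      interpret p: Vector_Spaces.linear s' "(*)" p by (rule p)
      define B where "B u v w = p (f u v w)" for u v w
      have "trilinear_on s V (*) B"
        using f by (auto simp: trilinear_on_def linear_on_def B_def p.add p.scale)
      with fun_cong[OF K(3), of B] have "(\<Sum>j\<in>K. c j * B (fst j) (fst (snd j)) (snd (snd j))) = 0"
        by (simp add: sum_apply fscale_def tensor3_def)
      then show "p (\<Sum>j\<in>K. s' (c j) (f (fst j) (fst (snd j)) (snd (snd j)))) = 0"
        by (simp add: p.sum p.scale B_def)
    qed
  qed
  then show ?thesis by auto
qed

lemma tensor2_map_tensor2: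
  assumes "linear_on s V s T" "linear_on s V s S" "T ` V \<subseteq> V" "S ` V \<subseteq> V"
  shows "tensor2_map s V T S (tensor2 s V u v) = tensor2 s V (T u) (S v)"
proof -
  have "bilinear_on s V (*) (\<lambda>u v. B (T u) (S v))" if "bilinear_on s V (*) B" for B
    using that assms by (auto simp: bilinear_on_def linear_on_def image_subset_iff)
  then show ?thesis by (auto simp: tensor2_map_def tensor2_def)
qed

lemma tensor2_map_linear:
  "linear_on fscale W fscale (tensor2_map s V T S)"
  by (auto simp: linear_on_def tensor2_map_def fscale_def fun_eq_iff)

lemma tensor_pairing_tensor2:
  assumes "f \<in> dual scale" "g \<in> dual scale"
  shows "tensor_pairing (tensor2 fscale (dual scale) f g) (tensor2 scale UNIV u v) = f u * g v"
proof -
  have 1: "bilinear_on scale UNIV (*) (\<lambda>u v. f u * g v)" if "f \<in> dual scale" "g \<in> dual scale" for f g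
    using that by (auto simp: bilinear_on_def linear_on_def dual_def Vector_Spaces.linear_iff algebra_simps)
  have "bilinear_on fscale (dual scale) (*) (\<lambda>f g. tensor2 scale UNIV u v (\<lambda>u v. f u * g v))"
    unfolding bilinear_on_def linear_on_def
  proof (intro conjI ballI allI, goal_cases)
    case prems: (1 f g h)
    then have "g + h \<in> dual scale" by (auto simp: dual_def Vector_Spaces.linear_iff algebra_simps)
    with prems 1[of f g] 1[of f h] 1[of f "g + h"] show ?case
      by (simp add: tensor2_def algebra_simps)
  next
    case prems: (2 f c g)
    then have "fscale c g \<in> dual scale" by (auto simp: dual_def Vector_Spaces.linear_iff fscale_def algebra_simps)
    with prems 1[of f g] 1[of f "fscale c g"] show ?case
      by (simp add: tensor2_def fscale_def algebra_simps)
  next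
    case prems: (3 f g h)
    then have "g + h \<in> dual scale" by (auto simp: dual_def Vector_Spaces.linear_iff algebra_simps)
    with prems 1[of g f] 1[of h f] 1[of "g + h" f] show ?case
      by (simp add: tensor2_def algebra_simps)
  next
    case prems: (4 f c g)
    then have "fscale c g \<in> dual scale" by (auto simp: dual_def Vector_Spaces.linear_iff fscale_def algebra_simps)
    with prems 1[of g f] 1[of "fscale c g" f] show ?case
      by (simp add: tensor2_def fscale_def algebra_simps)
  qed
  with 1[OF assms] show ?thesis by (simp add: tensor_pairing_def tensor2_def)
qed

end

theory Submission
  imports Defs
begin

text \<open>
  Let \<open>T : A\<^sup>* \<rightarrow> A\<close> be the contraction of \<open>r\<close>; it is self-adjoint because \<open>r\<close> is symmetric.
  The induced product is \<open>(f \<star> g) x = f (x \<cdot> T g) + g [x, T f]\<close>, and the \<open>S\<close>-equation says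
  exactly that \<open>T (f \<star> g) = T f \<cdot> T g\<close>. Left-symmetry of \<open>\<star>\<close> thereby reduces, after evaluation
  at \<open>x\<close>, to left-symmetry and the Jacobi identity in \<open>A\<close>. The map \<open>\<alpha>\<close> is a cocycle because it
  is a coboundary. Paired with \<open>x \<otimes> y\<close>, the action of \<open>f\<close> on \<open>\<beta> g\<close> is
  \<open>- g (T f \<cdot> (x \<cdot> y))\<close> plus terms symmetric in \<open>f\<close> and \<open>g\<close>, and
  \<open>[f, g] z = f (T g \<cdot> z) - g (T f \<cdot> z)\<close>, whence the cocycle condition for \<open>\<beta>\<close>.
\<close>

section \<open>Linear functionals and pure tensors\<close>

lemma dual_add: "f \<in> dual s \<Longrightarrow> f (x + y) = f x + f y"
  and dual_scale: "f \<in> dual s \<Longrightarrow> f (s c x) = c * f x"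
  by (auto simp: dual_def Vector_Spaces.linear_iff)

lemma dual_diff: "f \<in> dual s \<Longrightarrow> f (x - y) = f x - f y"
  by (metis dual_add add_diff_cancel_right' diff_add_cancel)

lemma dual_sum: "f \<in> dual s \<Longrightarrow> f (\<Sum>i\<in>I. g i) = (\<Sum>i\<in>I. f (g i))"
  \<comment> \<open>This instance gives \<open>f 0 = 0\<close>, the value required for the empty sum
    and for the sum over an infinite set, which is 0 by convention.\<close>
  using dual_diff[of f s 0 0]
  by (induction I rule: infinite_finite_induct) (auto simp: dual_add)

lemma dualI:
  assumes "vector_space s" "\<And>x y. f (x + y) = f x + f y" "\<And>c x. f (s c x) = c * f x"
  shows "f \<in> dual s"
  using assms vector_space_mult by (auto simp: dual_def Vector_Spaces.linear_iff)

lemma dual_separate: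
  assumes "vector_space s" "\<And>h. h \<in> dual s \<Longrightarrow> h x = h y"
  shows "x = y"
proof -
  have "x - y = 0"
    using assms by (intro functionals_separate[OF assms(1)]) (metis dual_def dual_diff mem_Collect_eq right_minus_eq)
  then show ?thesis by simp
qed

lemma bilinear_on_tensor_form:
  assumes "f \<in> dual s" "g \<in> dual s"
  shows "bilinear_on s V (*) (\<lambda>u v. f u * g v)"
  using assms by (auto simp: bilinear_on_def linear_on_def dual_add dual_scale algebra_simps)

lemma trilinear_on_tensor_form:
  assumes "f \<in> dual s" "g \<in> dual s" "h \<in> dual s"
  shows "trilinear_on s V (*) (\<lambda>u v w. f u * g v * h w)"
  using assms by (auto simp: trilinear_on_def linear_on_def dual_add dual_scale algebra_simps)

lemma tensor2_map_sum:
  "tensor2_map s V T S (\<Sum>i\<in>I. t i) = (\<Sum>i\<in>I. tensor2_map s V T S (t i))"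
  by (auto simp: fun_eq_iff tensor2_map_def sum_apply)

lemma L_ad_sum: "L_ad s V mult x (\<Sum>i\<in>I. t i) = (\<Sum>i\<in>I. L_ad s V mult x (t i))"
  by (simp add: L_ad_def tensor2_map_sum sum.distrib)

lemma tensor2_add_left:
  "u \<in> V \<Longrightarrow> u' \<in> V \<Longrightarrow> v \<in> V \<Longrightarrow> tensor2 s V (u + u') v = tensor2 s V u v + tensor2 s V u' v"
  and tensor2_add_right:
  "u \<in> V \<Longrightarrow> v \<in> V \<Longrightarrow> v' \<in> V \<Longrightarrow> tensor2 s V u (v + v') = tensor2 s V u v + tensor2 s V u v'"
  and tensor2_scale_left:
  "u \<in> V \<Longrightarrow> v \<in> V \<Longrightarrow> tensor2 s V (s c u) v = fscale c (tensor2 s V u v)"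
  and tensor2_scale_right:
  "u \<in> V \<Longrightarrow> v \<in> V \<Longrightarrow> tensor2 s V u (s c v) = fscale c (tensor2 s V u v)"
  using tensor2_bilinear[of s V] by (auto simp: bilinear_on_def linear_on_def)

lemma sum_tensor2_in_space:
  assumes "\<And>i. i \<in> I \<Longrightarrow> u i \<in> V" "\<And>i. i \<in> I \<Longrightarrow> v i \<in> V"
  shows "(\<Sum>i\<in>I. tensor2 s V (u i) (v i)) \<in> tensor2_space s V"
proof -
  interpret F: vector_space fscale by (rule vector_space_fscale)
  show ?thesis
    unfolding tensor2_space_def using assms by (intro F.span_sum F.span_base) blast
qed

lemma tensor2_space_add:
  "t \<in> tensor2_space s V \<Longrightarrow> t' \<in> tensor2_space s V \<Longrightarrow> t + t' \<in> tensor2_space s V"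
  unfolding tensor2_space_def
  by (rule module.span_add[OF vector_space_fscale[folded module_iff_vector_space]])

lemma fscale_add: "fscale c (f + g) = fscale c f + fscale c g"
  and fscale_sum: "fscale c (\<Sum>i\<in>I. h i) = (\<Sum>i\<in>I. fscale c (h i))"
  by (auto simp: fscale_def fun_eq_iff algebra_simps sum_apply sum_distrib_left)

lemma tensor2_sum_left:
  assumes s: "vector_space s" "module.subspace s V"
    and uv: "\<And>k. k \<in> K \<Longrightarrow> u k \<in> V" "v \<in> V"
  shows "tensor2 s V (\<Sum>k\<in>K. s (c k) (u k)) v = (\<Sum>k\<in>K. fscale (c k) (tensor2 s V (u k) v))"
proof -
  interpret vector_space s by (rule s)
  have "tensor2 s V 0 v = 0"
    using tensor2_add_left[of 0 V 0 v s] subspace_0[OF s(2)] uv by simp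
  then show ?thesis
    using uv s(2)
    by (induction K rule: infinite_finite_induct)
      (simp_all add: tensor2_add_left tensor2_scale_left subspace_scale subspace_sum)
qed

lemma tensor2_sum_right:
  assumes s: "vector_space s" "module.subspace s V"
    and uv: "\<And>k. k \<in> K \<Longrightarrow> v k \<in> V" "u \<in> V"
  shows "tensor2 s V u (\<Sum>k\<in>K. s (c k) (v k)) = (\<Sum>k\<in>K. fscale (c k) (tensor2 s V u (v k)))"
proof -
  interpret vector_space s by (rule s)
  have "tensor2 s V u 0 = 0"
    using tensor2_add_right[of u V 0 0 s] subspace_0[OF s(2)] uv by simp
  then show ?thesis
    using uv s(2)
    by (induction K rule: infinite_finite_induct)
      (simp_all add: tensor2_add_right tensor2_scale_right subspace_scale subspace_sum)
qed

lemma tensor_pairing_add: "tensor_pairing (t + t') z = tensor_pairing t z + tensor_pairing t' z"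
  by (simp add: tensor_pairing_def)

section \<open>The sub-adjacent Lie algebra, its representations and coboundaries\<close>

context left_symmetric_algebra
begin

lemma mult_add_right: "x \<in> V \<Longrightarrow> y \<in> V \<Longrightarrow> z \<in> V \<Longrightarrow> mult x (y + z) = mult x y + mult x z"
  and mult_add_left: "x \<in> V \<Longrightarrow> y \<in> V \<Longrightarrow> z \<in> V \<Longrightarrow> mult (x + y) z = mult x z + mult y z"
  and mult_scale_right: "x \<in> V \<Longrightarrow> y \<in> V \<Longrightarrow> mult x (scale c y) = scale c (mult x y)"
  and mult_scale_left: "x \<in> V \<Longrightarrow> y \<in> V \<Longrightarrow> mult (scale c x) y = scale c (mult x y)"
  using mult_bilinear by (auto simp: bilinear_on_def linear_on_def)

lemma mult_diff_right: "x \<in> V \<Longrightarrow> y \<in> V \<Longrightarrow> z \<in> V \<Longrightarrow> mult x (y - z) = mult x y - mult x z"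
  by (metis add_diff_cancel_right' diff_add_cancel mult_add_right subspace subspace_diff)

lemma mult_diff_left: "x \<in> V \<Longrightarrow> y \<in> V \<Longrightarrow> z \<in> V \<Longrightarrow> mult (x - y) z = mult x z - mult y z"
  by (metis add_diff_cancel_right' diff_add_cancel mult_add_left subspace subspace_diff)

lemma commutator_closed: "x \<in> V \<Longrightarrow> y \<in> V \<Longrightarrow> commutator mult x y \<in> V"
  by (simp add: commutator_def mult_closed subspace subspace_diff)

text \<open>Left-symmetry, regrouped: left multiplication is a representation of the sub-adjacent
  Lie algebra.\<close>

lemma mult_commutator_left:
  assumes "x \<in> V" "y \<in> V" "z \<in> V"
  shows "mult (commutator mult x y) z = mult x (mult y z) - mult y (mult x z)"
  using left_symmetric[OF assms] assms mult_closed
  by (simp add: commutator_def mult_diff_left algebra_simps)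

lemma commutator_add_left:
    "x \<in> V \<Longrightarrow> y \<in> V \<Longrightarrow> z \<in> V \<Longrightarrow> commutator mult (x + y) z = commutator mult x z + commutator mult y z"
  and commutator_add_right:
    "x \<in> V \<Longrightarrow> y \<in> V \<Longrightarrow> z \<in> V \<Longrightarrow> commutator mult x (y + z) = commutator mult x y + commutator mult x z"
  and commutator_scale_left:
    "x \<in> V \<Longrightarrow> y \<in> V \<Longrightarrow> commutator mult (scale c x) y = scale c (commutator mult x y)"
  and commutator_scale_right:
    "x \<in> V \<Longrightarrow> y \<in> V \<Longrightarrow> commutator mult x (scale c y) = scale c (commutator mult x y)"
  by (auto simp: commutator_def mult_add_left mult_add_right mult_scale_left mult_scale_right
      scale_right_diff_distrib)

lemma jacobi:
  assumes "x \<in> V" "y \<in> V" "z \<in> V"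
  shows "commutator mult (commutator mult x y) z =
    commutator mult x (commutator mult y z) - commutator mult y (commutator mult x z)"
proof -
  \<comment> \<open>The three cyclic instances of left-symmetry, oriented to eliminate (xy)z, (yz)x
    and (zx)y in favour of (yx)z, (zy)x and (xz)y; everything then cancels.\<close>
  have expand: "mult (mult x y) z = mult (mult y x) z - mult y (mult x z) + mult x (mult y z)"
    "mult (mult y z) x = mult (mult z y) x - mult z (mult y x) + mult y (mult z x)"
    "mult (mult z x) y = mult (mult x z) y - mult x (mult z y) + mult z (mult x y)"
    using left_symmetric[OF assms] left_symmetric[OF assms(2,3,1)] left_symmetric[OF assms(3,1,2)]
    by (simp_all add: algebra_simps)
  show ?thesis
    using assms
    by (simp add: commutator_def mult_diff_left mult_diff_right mult_closed expand algebra_simps)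
qed

lemma L_ad_tensor2:
  assumes "x \<in> V"
  shows "L_ad scale V mult x (tensor2 scale V u v) =
    tensor2 scale V (mult x u) v + tensor2 scale V u (commutator mult x v)"
proof -
  have "linear_on scale V scale (mult x)" "linear_on scale V scale (commutator mult x)"
    "linear_on scale V scale (\<lambda>v. v)"
    using assms by (auto simp: linear_on_def mult_add_right mult_scale_right
        commutator_add_right commutator_scale_right)
  then show ?thesis
    using assms by (auto simp: L_ad_def tensor2_map_tensor2 mult_closed commutator_closed image_subset_iff)
qed

lemma L_ad_add: "L_ad scale V mult x (s + t) = L_ad scale V mult x s + L_ad scale V mult x t"
  by (auto simp: L_ad_def tensor2_map_def fun_eq_iff)

text \<open>The first factor obeys the representation law for L, the second the one for ad, which is
  the Jacobi identity. The mixed terms, with \<open>x\<close> acting on one factor and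
  \<open>y\<close> on the other, are symmetric in \<open>x\<close> and \<open>y\<close> and
  cancel.\<close>

lemma L_ad_commutator_tensor2:
  assumes "x \<in> V" "y \<in> V" "u \<in> V" "v \<in> V"
  shows "L_ad scale V mult (commutator mult x y) (tensor2 scale V u v) =
    L_ad scale V mult x (L_ad scale V mult y (tensor2 scale V u v)) -
    L_ad scale V mult y (L_ad scale V mult x (tensor2 scale V u v))"
proof -
  have diff_left: "tensor2 scale V (p - q) v = tensor2 scale V p v - tensor2 scale V q v"
    if "p \<in> V" "q \<in> V" for p q
    using that assms tensor2_add_left[of "p - q" V q v scale] subspace_diff[OF subspace] by simp
  have diff_right: "tensor2 scale V u (p - q) = tensor2 scale V u p - tensor2 scale V u q"
    if "p \<in> V" "q \<in> V" for p q
    using that assms tensor2_add_right[of u V "p - q" q scale] subspace_diff[OF subspace] by simp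
  show ?thesis
    using assms
    by (simp add: L_ad_tensor2 L_ad_add mult_commutator_left jacobi diff_left diff_right
        commutator_closed mult_closed)
qed

text \<open>For a map of the form x -> \<rho>(x) t the cocycle condition is the representation law
  of \<rho> evaluated at t, and it can be checked on each pure tensor of the sum.\<close>

lemma one_cocycle_coboundary:
  assumes "\<And>i. i \<in> I \<Longrightarrow> a i \<in> V" "\<And>i. i \<in> I \<Longrightarrow> b i \<in> V"
  shows "one_cocycle scale V (commutator mult) fscale (tensor2_space scale V) (L_ad scale V mult)
    (\<lambda>x. L_ad scale V mult x (\<Sum>i\<in>I. tensor2 scale V (a i) (b i)))"
  unfolding one_cocycle_def linear_on_def
proof (intro conjI ballI allI)
  have "L_ad scale V mult x (\<Sum>i\<in>I. tensor2 scale V (a i) (b i)) \<in> tensor2_space scale V"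
    if "x \<in> V" for x
  proof -
    have "L_ad scale V mult x (\<Sum>i\<in>I. tensor2 scale V (a i) (b i)) =
      (\<Sum>i\<in>I. tensor2 scale V (mult x (a i)) (b i)) +
      (\<Sum>i\<in>I. tensor2 scale V (a i) (commutator mult x (b i)))"
      using that by (simp add: L_ad_sum L_ad_tensor2 sum.distrib)
    moreover have "(\<Sum>i\<in>I. tensor2 scale V (mult x (a i)) (b i)) \<in> tensor2_space scale V"
      "(\<Sum>i\<in>I. tensor2 scale V (a i) (commutator mult x (b i))) \<in> tensor2_space scale V"
      using that assms by (auto intro!: sum_tensor2_in_space mult_closed commutator_closed)
    ultimately show ?thesis
      by (simp add: tensor2_space_add)
  qed
  then show "(\<lambda>x. L_ad scale V mult x (\<Sum>i\<in>I. tensor2 scale V (a i) (b i))) ` V \<subseteq> tensor2_space scale V"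
    by blast
next
  fix x y assume "x \<in> V" "y \<in> V"
  then show "L_ad scale V mult (x + y) (\<Sum>i\<in>I. tensor2 scale V (a i) (b i)) =
    L_ad scale V mult x (\<Sum>i\<in>I. tensor2 scale V (a i) (b i)) +
    L_ad scale V mult y (\<Sum>i\<in>I. tensor2 scale V (a i) (b i))"
    unfolding L_ad_sum sum.distrib[symmetric] using assms
    by (intro sum.cong refl) (simp add: L_ad_tensor2 subspace subspace_add mult_add_left
        commutator_add_left tensor2_add_left tensor2_add_right mult_closed commutator_closed)
next
  fix c x assume "x \<in> V"
  then show "L_ad scale V mult (scale c x) (\<Sum>i\<in>I. tensor2 scale V (a i) (b i)) =
    fscale c (L_ad scale V mult x (\<Sum>i\<in>I. tensor2 scale V (a i) (b i)))"
    unfolding L_ad_sum fscale_sum using assms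
    by (intro sum.cong refl) (simp add: L_ad_tensor2 subspace subspace_scale mult_scale_left
        commutator_scale_left tensor2_scale_left tensor2_scale_right mult_closed commutator_closed
        fscale_add)
next
  fix x y assume "x \<in> V" "y \<in> V"
  then show "L_ad scale V mult (commutator mult x y) (\<Sum>i\<in>I. tensor2 scale V (a i) (b i)) =
    L_ad scale V mult x (L_ad scale V mult y (\<Sum>i\<in>I. tensor2 scale V (a i) (b i))) -
    L_ad scale V mult y (L_ad scale V mult x (\<Sum>i\<in>I. tensor2 scale V (a i) (b i)))"
    unfolding L_ad_sum sum_subtractf[symmetric] using assms
    by (intro sum.cong refl L_ad_commutator_tensor2) auto
qed

end

section \<open>Coordinate functionals\<close>

lemma dual_basis:
  assumes "vector_space s" "finite G" "module.span s G = UNIV"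
  obtains E :: "'a::ab_group_add set" and e :: "'a \<Rightarrow> 'a \<Rightarrow> 'k::field"
  where "finite E" "\<And>p. e p \<in> dual s" "\<And>x. (\<Sum>p\<in>E. s (e p x) p) = x"
proof -
  interpret vector_space s by fact
  obtain E where E: "independent E" "UNIV \<subseteq> span E"
    using maximal_independent_subset[of UNIV] by blast
  have fin: "finite E"
    using independent_span_bound[OF assms(2) E(1)] assms(3) by auto
  \<comment> \<open>Coordinates with respect to the basis \<open>E\<close>; for \<open>p\<close>
    outside \<open>E\<close> this is the zero functional.\<close>
  define e where "e p x = representation E x p" for p x
  show thesis
  proof
    show "finite E" by (rule fin)
    show "e p \<in> dual s" for p
      using E by (intro dualI) (auto simp: e_def representation_add representation_scale
          assms(1) subset_iff)
    show "(\<Sum>p\<in>E. s (e p x) p) = x" for x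
      unfolding e_def using E fin by (intro sum_representation_eq) auto
  qed
qed

section \<open>Contraction with a symmetric solution of the S-equation\<close>

locale symmetric_S_solution = left_symmetric_algebra scale UNIV mult
  for scale :: "'k::field \<Rightarrow> 'a::ab_group_add \<Rightarrow> 'a" and mult :: "'a \<Rightarrow> 'a \<Rightarrow> 'a" +
  fixes I :: "'i set" and a b :: "'i \<Rightarrow> 'a"
  assumes symmetric: "(\<Sum>i\<in>I. tensor2 scale UNIV (a i) (b i)) = (\<Sum>i\<in>I. tensor2 scale UNIV (b i) (a i))"
    and S_eq: "S_equation scale UNIV mult I a b"
begin

definition T :: "('a \<Rightarrow> 'k) \<Rightarrow> 'a" where
  "T f = (\<Sum>i\<in>I. scale (f (a i)) (b i))"

definition \<delta> :: "'a \<Rightarrow> ('a \<Rightarrow> 'a \<Rightarrow> 'k) \<Rightarrow> 'k" where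
  "\<delta> x = L_ad scale UNIV mult x (\<Sum>i\<in>I. tensor2 scale UNIV (a i) (b i))"

abbreviation D where "D \<equiv> dual scale"

abbreviation star (infixl "\<star>" 70) where "f \<star> g \<equiv> dual_product scale \<delta> f g"

abbreviation br where "br \<equiv> commutator mult"

lemma mult_sum_right: "mult x (\<Sum>i\<in>J. g i) = (\<Sum>i\<in>J. mult x (g i))"
  using mult_diff_right[of x 0 0]
  by (induction J rule: infinite_finite_induct) (auto simp: mult_add_right)

lemma mult_sum_left: "mult (\<Sum>i\<in>J. g i) x = (\<Sum>i\<in>J. mult (g i) x)"
  using mult_diff_left[of 0 0 x]
  by (induction J rule: infinite_finite_induct) (auto simp: mult_add_left)

lemma dual_mult_sum:
  assumes "h \<in> D"
  shows "h (mult (\<Sum>i\<in>J. scale (c i) (u i)) (\<Sum>k\<in>K. scale (d k) (v k))) =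
    (\<Sum>i\<in>J. \<Sum>k\<in>K. c i * d k * h (mult (u i) (v k)))"
  unfolding mult_sum_left unfolding mult_sum_right using assms
  by (simp add: mult_scale_left mult_scale_right dual_sum dual_scale mult_ac
      sum_distrib_left)

lemma dual_T: "h \<in> D \<Longrightarrow> h (T f) = (\<Sum>i\<in>I. f (a i) * h (b i))"
  by (simp add: T_def dual_sum dual_scale)

text \<open>Equal tensors agree at the bilinear form \<open>f u * h v\<close>; the two values of the
  symmetry equation there are \<open>h (T f)\<close> and \<open>f (T h)\<close>.\<close>

lemma T_symmetric:
  assumes "f \<in> D" "h \<in> D"
  shows "h (T f) = f (T h)"
  using fun_cong[OF symmetric, of "\<lambda>u v. f u * h v"] assms
  by (simp add: dual_T sum_apply tensor2_def bilinear_on_tensor_form algebra_simps)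

text \<open>Symmetry permits contraction in the second factor as well. Both expansions are used
  below, because a functional may meet \<open>a i\<close> in one term and \<open>b i\<close> in
  another.\<close>

lemma T_alt:
  assumes "f \<in> D"
  shows "T f = (\<Sum>i\<in>I. scale (f (b i)) (a i))"
proof (rule dual_separate[OF vector_space_axioms])
  fix h assume h: "h \<in> D"
  show "h (T f) = h (\<Sum>i\<in>I. scale (f (b i)) (a i))"
    using T_symmetric[OF assms h] h assms by (simp add: dual_T dual_sum dual_scale mult.commute)
qed

lemma T_add: "T (f + g) = T f + T g"
  by (simp add: T_def scale_left_distrib sum.distrib)

lemma T_fscale: "T (fscale c f) = scale c (T f)"
  by (simp add: T_def fscale_def scale_sum_right)

text \<open>The \<open>S\<close>-equation paired with \<open>f \<otimes> g \<otimes> h\<close>.\<close>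

lemma S_equation_T:
  assumes "f \<in> D" "g \<in> D" "h \<in> D"
  shows "h (br (T f) (T g)) = f (mult (T g) (T h)) - g (mult (T f) (T h))"
proof -
  have "(\<Sum>i\<in>I. \<Sum>j\<in>I. - (f (mult (a i) (a j)) * g (b i) * h (b j))
      + f (a i) * g (mult (b i) (a j)) * h (b j)
      + f (a i) * g (a j) * h (br (b i) (b j))) = 0"
    using fun_cong[OF S_eq[unfolded S_equation_def], of "\<lambda>u v w. f u * g v * h w"] assms
    by (simp add: sum_apply tensor3_def trilinear_on_tensor_form)
  moreover have "f (mult (T g) (T h)) = (\<Sum>i\<in>I. \<Sum>j\<in>I. f (mult (a i) (a j)) * g (b i) * h (b j))"
    unfolding T_alt[OF assms(2)] T_alt[OF assms(3)] dual_mult_sum[OF assms(1)]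
    by (simp add: algebra_simps)
  moreover have "g (mult (T f) (T h)) = (\<Sum>i\<in>I. \<Sum>j\<in>I. f (a i) * g (mult (b i) (a j)) * h (b j))"
    unfolding T_alt[OF assms(3)] T_def[of f] dual_mult_sum[OF assms(2)]
    by (simp add: algebra_simps)
  moreover have "h (mult (T f) (T g)) = (\<Sum>i\<in>I. \<Sum>j\<in>I. f (a i) * g (a j) * h (mult (b i) (b j)))"
    unfolding T_def dual_mult_sum[OF assms(3)] by (simp add: algebra_simps)
  moreover have "h (mult (T g) (T f)) = (\<Sum>i\<in>I. \<Sum>j\<in>I. f (a i) * g (a j) * h (mult (b j) (b i)))"
    unfolding T_def dual_mult_sum[OF assms(3)] by (subst sum.swap) (simp add: algebra_simps)
  ultimately show ?thesis
    using assms by (simp add: commutator_def dual_diff sum.distrib sum_subtractf sum_negf algebra_simps)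
qed

section \<open>The induced product on the dual space\<close>

lemma \<delta>_apply:
  assumes "f \<in> D" "g \<in> D"
  shows "\<delta> x (\<lambda>u v. f u * g v) = f (mult x (T g)) + g (br x (T f))"
proof -
  have "\<delta> x (\<lambda>u v. f u * g v) = (\<Sum>i\<in>I. f (mult x (a i)) * g (b i)) + (\<Sum>i\<in>I. f (a i) * g (br x (b i)))"
    using assms unfolding \<delta>_def L_ad_sum L_ad_tensor2[OF UNIV_I] sum.distrib
    by (simp add: sum_apply tensor2_def bilinear_on_tensor_form)
  \<comment> \<open>Under \<open>L \<otimes> 1\<close> the untouched factor is \<open>b i\<close>,
    so \<open>g\<close> contracts \<open>r\<close> in the second factor; under
    \<open>1 \<otimes> ad\<close> it is \<open>a i\<close>, and \<open>f\<close> contracts in the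
    first.\<close>
  also have "(\<Sum>i\<in>I. f (mult x (a i)) * g (b i)) = f (mult x (T g))"
    using assms by (simp add: T_alt mult_sum_right mult_scale_right dual_sum dual_scale algebra_simps)
  also have "(\<Sum>i\<in>I. f (a i) * g (br x (b i))) = g (br x (T f))"
    using assms by (simp add: T_def commutator_def dual_diff mult_sum_right mult_sum_left
        mult_scale_right mult_scale_left dual_sum dual_scale algebra_simps sum_subtractf)
  finally show ?thesis .
qed

lemma D_add: "f \<in> D \<Longrightarrow> g \<in> D \<Longrightarrow> f + g \<in> D"
  and D_fscale: "f \<in> D \<Longrightarrow> fscale c f \<in> D"
  by (auto intro!: dualI vector_space_axioms simp: dual_add dual_scale fscale_def algebra_simps)

lemma D_mult_right: "f \<in> D \<Longrightarrow> (\<lambda>x. f (mult x y)) \<in> D"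
  and D_mult_left: "f \<in> D \<Longrightarrow> (\<lambda>x. f (mult y x)) \<in> D"
  by (auto intro!: dualI vector_space_axioms
      simp: dual_add dual_scale mult_add_left mult_add_right mult_scale_left mult_scale_right)

lemma star_apply:
  assumes "f \<in> D" "g \<in> D"
  shows "(f \<star> g) x = f (mult x (T g)) + g (br x (T f))"
proof -
  \<comment> \<open>A tensor takes the value 0 at functions that are not bilinear, so this check is
    what lets the pairing evaluate to \<open>\<delta> x\<close> at \<open>f u * g v\<close>.\<close>
  have "bilinear_on fscale D (*) (\<lambda>f g. \<delta> x (\<lambda>u v. f u * g v))"
    by (auto simp: bilinear_on_def linear_on_def \<delta>_apply D_add D_fscale T_add T_fscale
        mult_add_right mult_scale_right commutator_add_right commutator_scale_right
        dual_add dual_scale simp del: plus_fun_apply)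
      (auto simp: fscale_def algebra_simps)
  then show ?thesis
    using assms by (simp add: dual_product_def dual_map_def tensor_pairing_def tensor2_def \<delta>_apply)
qed

lemma star_closed:
  assumes "f \<in> D" "g \<in> D"
  shows "f \<star> g \<in> D"
  using assms by (intro dualI vector_space_axioms)
    (auto simp: star_apply mult_add_left mult_scale_left commutator_add_left commutator_scale_left
      dual_add dual_scale algebra_simps)

text \<open>The terms with \<open>x\<close> as left factor are symmetric in \<open>f\<close> and
  \<open>g\<close> and cancel. With L' the dual of the representation L, the bracket is
  \<open>L'(T f) g - L'(T g) f\<close>.\<close>

lemma commutator_star_apply:
  assumes "f \<in> D" "g \<in> D"
  shows "commutator (\<star>) f g x = f (mult (T g) x) - g (mult (T f) x)"
  using assms by (simp add: commutator_def star_apply dual_diff)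

text \<open>Tested against \<open>h\<close>, self-adjointness turns the left side into
  \<open>(f \<star> g) (T h)\<close>; the S-equation paired with \<open>h\<close>, \<open>f\<close>,
  \<open>g\<close> in this order cancels the term in \<open>f\<close> and leaves
  \<open>h (mult (T f) (T g))\<close>.\<close>

lemma T_star:
  assumes "f \<in> D" "g \<in> D"
  shows "T (f \<star> g) = mult (T f) (T g)"
proof (rule dual_separate[OF vector_space_axioms])
  fix h assume h: "h \<in> D"
  have "h (T (f \<star> g)) = f (mult (T h) (T g)) + g (br (T h) (T f))"
    using assms h by (simp add: T_symmetric[OF star_closed] star_apply)
  then show "h (T (f \<star> g)) = h (mult (T f) (T g))"
    using S_equation_T[of h f g] assms h by simp
qed

lemma star_left_symmetric:
  assumes "f \<in> D" "g \<in> D" "h \<in> D"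
  shows "(f \<star> g) \<star> h - f \<star> (g \<star> h) = (g \<star> f) \<star> h - g \<star> (f \<star> h)"
proof
  fix x
  \<comment> \<open>Expanded at \<open>x\<close>, with \<open>T_star\<close> removing nested
    products under \<open>T\<close>, every term is a value of \<open>f\<close>, \<open>g\<close> or
    \<open>h\<close>. The arguments of \<open>f\<close> balance by left-symmetry for
    \<open>x\<close>, \<open>T g\<close>, \<open>T h\<close>, those of \<open>g\<close> by
    left-symmetry for \<open>x\<close>, \<open>T f\<close>, \<open>T h\<close>, and those of
    \<open>h\<close> by Jacobi.\<close>
  have f: "mult (mult x (T g)) (T h) - mult x (mult (T g) (T h)) =
      mult (mult (T g) x) (T h) - mult (T g) (mult x (T h))"
    and g: "mult (mult x (T f)) (T h) - mult x (mult (T f) (T h)) =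
      mult (mult (T f) x) (T h) - mult (T f) (mult x (T h))"
    by (auto intro: left_symmetric)
  have j: "br x (mult (T f) (T g)) - br x (mult (T g) (T f)) =
      br (br x (T f)) (T g) - br (br x (T g)) (T f)"
    using jacobi[of "T f" "T g" x]
    by (simp add: commutator_def mult_diff_left mult_diff_right algebra_simps)
  show "((f \<star> g) \<star> h - f \<star> (g \<star> h)) x = ((g \<star> f) \<star> h - g \<star> (f \<star> h)) x"
    using arg_cong[OF f, of f] arg_cong[OF g, of g] arg_cong[OF j, of h] assms
    by (simp add: star_apply star_closed T_star commutator_def mult_diff_left mult_diff_right
        dual_diff dual_add algebra_simps)
qed

lemma star_bilinear: "bilinear_on fscale D fscale (\<star>)"
  by (auto simp: bilinear_on_def linear_on_def fun_eq_iff star_apply D_add D_fscale T_add T_fscale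
        mult_add_right mult_scale_right commutator_add_right commutator_scale_right
        dual_add dual_scale)
      (auto simp: fscale_def star_apply algebra_simps)

section \<open>Finite dimension of the dual space and tensors over it\<close>

lemma dual_expand:
  assumes "\<And>p. e p \<in> D" "\<And>x. (\<Sum>p\<in>E. scale (e p x) p) = x" "f \<in> D"
  shows "f = (\<Sum>p\<in>E. fscale (f p) (e p))"
proof
  fix x
  show "f x = (\<Sum>p\<in>E. fscale (f p) (e p)) x"
    using arg_cong[OF assms(2)[of x], of f] assms(3)
    by (simp add: dual_sum dual_scale sum_apply fscale_def mult.commute)
qed

lemma basis_exists:
  obtains E :: "'a set" and e :: "'a \<Rightarrow> 'a \<Rightarrow> 'k"
  where "finite E" "\<And>p. e p \<in> D" "\<And>x. (\<Sum>p\<in>E. scale (e p x) p) = x"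
  using dual_basis[OF vector_space_axioms] finite_dim by metis

lemma star_algebra: "left_symmetric_algebra fscale D (\<star>)"
proof -
  interpret F: vector_space fscale by (rule vector_space_fscale)
  show ?thesis
  proof
    show "F.subspace D" by (rule subspace_dual[OF vector_space_axioms])
    obtain E and e :: "'a \<Rightarrow> 'a \<Rightarrow> 'k" where E: "finite E" "\<And>p. e p \<in> D" "\<And>x. (\<Sum>p\<in>E. scale (e p x) p) = x"
      by (rule basis_exists) metis
    have "F.span (e ` E) = D"
    proof
      show "F.span (e ` E) \<subseteq> D"
        using E(2) subspace_dual[OF vector_space_axioms] by (intro F.span_minimal) auto
      show "D \<subseteq> F.span (e ` E)"
      proof
        fix f assume "f \<in> D"
        then show "f \<in> F.span (e ` E)"
          by (subst dual_expand[OF E(2,3) \<open>f \<in> D\<close>]) (intro F.span_sum F.span_scale F.span_base imageI)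
      qed
    qed
    with E(1) show "\<exists>B. finite B \<and> F.span B = D" by blast
  qed (auto simp: star_closed star_bilinear star_left_symmetric)
qed

text \<open>Makes the representation and coboundary lemmas available on the dual algebra
  too.\<close>

sublocale star: left_symmetric_algebra fscale D "(\<star>)"
  by (rule star_algebra)

text \<open>A tensor over the dual is rebuilt from its values on pairs from the finite set
  \<open>E\<close>. Identities between such tensors thus become identities of bilinear forms on
  A.\<close>

lemma dual_tensor_eqI:
  assumes "t \<in> tensor2_space fscale D" "t' \<in> tensor2_space fscale D"
    and "\<And>x y. tensor_pairing t (tensor2 scale UNIV x y) = tensor_pairing t' (tensor2 scale UNIV x y)"
  shows "t = t'"
proof -
  interpret F: vector_space "fscale :: 'k \<Rightarrow> ((('a \<Rightarrow> 'k) \<Rightarrow> ('a \<Rightarrow> 'k) \<Rightarrow> 'k) \<Rightarrow> 'k) \<Rightarrow> _"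
    by (rule vector_space_fscale)
  obtain E and e :: "'a \<Rightarrow> 'a \<Rightarrow> 'k" where E: "finite E" "\<And>p. e p \<in> D" "\<And>x. (\<Sum>p\<in>E. scale (e p x) p) = x"
    by (rule basis_exists) metis
  define P where "P t x y = tensor_pairing t (tensor2 scale UNIV x y)"
    for t :: "(('a \<Rightarrow> 'k) \<Rightarrow> ('a \<Rightarrow> 'k) \<Rightarrow> 'k) \<Rightarrow> 'k" and x y
  \<comment> \<open>\<open>N\<close> is the reconstruction map. It is linear, and it fixes
    \<open>f \<otimes> g\<close> because both factors expand in the functionals \<open>e p\<close>;
    hence it fixes the span.\<close>
  define N where "N t = (\<Sum>p\<in>E. \<Sum>q\<in>E. fscale (P t p q) (tensor2 fscale D (e p) (e q)))" for t
  have "N t = t" if "t \<in> tensor2_space fscale D" for t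
    using that unfolding tensor2_space_def
  proof (induction rule: F.span_induct_alt)
    case base
    show ?case
      by (simp add: N_def P_def tensor_pairing_def)
  next
    case (step c x y)
    then obtain f g where fg: "x = tensor2 fscale D f g" "f \<in> D" "g \<in> D" by auto
    have "x = (\<Sum>p\<in>E. fscale (f p) (tensor2 fscale D (e p) g))"
      unfolding fg(1) using E fg
      by (subst dual_expand[OF E(2,3) fg(2)])
        (simp add: tensor2_sum_left vector_space_fscale star.subspace)
    also have "\<dots> = (\<Sum>p\<in>E. \<Sum>q\<in>E. fscale (f p) (fscale (g q) (tensor2 fscale D (e p) (e q))))"
      using E fg
      by (subst dual_expand[OF E(2,3) fg(3)])
        (simp add: tensor2_sum_right vector_space_fscale star.subspace fscale_sum)
    finally have x: "x = (\<Sum>p\<in>E. \<Sum>q\<in>E. fscale (f p) (fscale (g q) (tensor2 fscale D (e p) (e q))))" .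
    have "P x p q = f p * g q" for p q
      using fg by (simp add: P_def tensor_pairing_tensor2)
    then have "N x = x"
      by (subst x) (simp add: N_def)
    moreover have "N (fscale c x + y) = fscale c (N x) + N y"
      by (simp add: N_def P_def tensor_pairing_def fscale_def[of c x] F.scale_left_distrib sum.distrib
          fscale_sum)
    ultimately show ?case by (simp only: step.IH)
  qed
  with assms show ?thesis
    by (metis (no_types, lifting) N_def P_def sum.cong)
qed

section \<open>The comultiplication dual to the product of A\<close>

lemma dual_comultiplication:
  "\<exists>\<beta>. (\<forall>f\<in>D. \<forall>x y. tensor_pairing (\<beta> f) (tensor2 scale UNIV x y) = f (mult x y)) \<and>
    one_cocycle fscale D (commutator (\<star>)) fscale (tensor2_space fscale D) (L_ad fscale D (\<star>)) \<beta>"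
proof -
  obtain E and e :: "'a \<Rightarrow> 'a \<Rightarrow> 'k" where E: "finite E" "\<And>p. e p \<in> D" "\<And>x. (\<Sum>p\<in>E. scale (e p x) p) = x"
    by (rule basis_exists) metis
  \<comment> \<open>The bilinear form \<open>f (mult x y)\<close> written as a tensor by expanding
    \<open>x\<close> in \<open>E\<close>; \<open>eval\<close> undoes this expansion.\<close>
  define \<beta> where "\<beta> f = (\<Sum>p\<in>E. tensor2 fscale D (e p) (\<lambda>y. f (mult p y)))" for f
  have eval: "(\<Sum>p\<in>E. e p x * f p) = f x" if "f \<in> D" for f x
    using arg_cong[OF E(3)[of x], of f] that by (simp add: dual_sum dual_scale)
  have \<beta>_space: "\<beta> f \<in> tensor2_space fscale D" if "f \<in> D" for f
    unfolding \<beta>_def using that E(2) by (intro sum_tensor2_in_space D_mult_left)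
  \<comment> \<open>\<open>\<beta> g\<close> is a sum of pure tensors, so its coboundary takes
    values in the tensor space.\<close>
  have L_ad_space: "L_ad fscale D (\<star>) f (\<beta> g) \<in> tensor2_space fscale D" if "f \<in> D" "g \<in> D" for f g
    using star.one_cocycle_coboundary[of E e "\<lambda>p y. g (mult p y)"] that E(2) D_mult_left
    by (auto simp: one_cocycle_def \<beta>_def)
  have pairing_sum: "tensor_pairing (\<Sum>k\<in>K. t k) z = (\<Sum>k\<in>K. tensor_pairing (t k) z)"
    for K :: "'a set" and t :: "'a \<Rightarrow> (('a \<Rightarrow> 'k) \<Rightarrow> ('a \<Rightarrow> 'k) \<Rightarrow> 'k) \<Rightarrow> 'k" and z
    by (simp add: tensor_pairing_def sum_apply)
  have \<beta>_pairing: "tensor_pairing (\<beta> f) (tensor2 scale UNIV x y) = f (mult x y)" if "f \<in> D" for f x y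
    using that E(2) by (simp add: \<beta>_def pairing_sum tensor_pairing_tensor2 D_mult_left
        eval[OF D_mult_right])
  have L_ad_pairing: "tensor_pairing (L_ad fscale D (\<star>) f (\<beta> g)) (tensor2 scale UNIV x y) =
      g (mult (T (\<lambda>z. f (mult x z))) y) + f (mult (T (\<lambda>z. g (mult x z))) y) - g (mult (T f) (mult x y))"
    if f: "f \<in> D" and g: "g \<in> D" for f g x y
  proof -
    have "tensor_pairing (L_ad fscale D (\<star>) f (\<beta> g)) (tensor2 scale UNIV x y) =
      (\<Sum>p\<in>E. (f \<star> e p) x * g (mult p y)) +
      (\<Sum>p\<in>E. e p x * commutator (\<star>) f (\<lambda>y. g (mult p y)) y)"
      using f g E(2) star.commutator_closed star_closed
      by (simp add: \<beta>_def L_ad_sum star.L_ad_tensor2 sum.distrib tensor_pairing_tensor2 D_mult_left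
          pairing_sum tensor_pairing_add)
    \<comment> \<open>Self-adjointness frees \<open>e p\<close> from inside \<open>T\<close>, so
      that the sum over \<open>p\<close> collapses by \<open>eval\<close>.\<close>
    also have "(\<Sum>p\<in>E. (f \<star> e p) x * g (mult p y)) =
      (\<Sum>p\<in>E. e p (T (\<lambda>z. f (mult x z))) * g (mult p y)) + (\<Sum>p\<in>E. e p (br x (T f)) * g (mult p y))"
      using f E(2) T_symmetric[OF D_mult_left[OF f] E(2)]
      by (simp add: star_apply sum.distrib distrib_right)
    also have "\<dots> = g (mult (T (\<lambda>z. f (mult x z))) y) + g (mult (br x (T f)) y)"
      by (simp add: eval[OF D_mult_right[OF g]])
    also have "(\<Sum>p\<in>E. e p x * commutator (\<star>) f (\<lambda>y. g (mult p y)) y) =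
      (\<Sum>p\<in>E. e p x * g (mult p (T (\<lambda>w. f (mult w y))))) - (\<Sum>p\<in>E. e p x * g (mult p (mult (T f) y)))"
      using f g T_symmetric[OF D_mult_left[OF g] D_mult_right[OF f]]
      by (simp add: commutator_star_apply D_mult_left sum_subtractf right_diff_distrib)
    also have "\<dots> = g (mult x (T (\<lambda>w. f (mult w y)))) - g (mult x (mult (T f) y))"
      by (simp add: eval[OF D_mult_right[OF g]])
    \<comment> \<open>Self-adjointness again: this is the first term with \<open>f\<close> and
      \<open>g\<close> exchanged.\<close>
    also have "g (mult x (T (\<lambda>w. f (mult w y)))) = f (mult (T (\<lambda>z. g (mult x z))) y)"
      using T_symmetric[OF D_mult_left[OF g] D_mult_right[OF f]] by simp
    \<comment> \<open>Expanding left multiplication by \<open>br x (T f)\<close> cancels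
      \<open>g (mult x (mult (T f) y))\<close> and leaves
      \<open>- g (mult (T f) (mult x y))\<close>.\<close>
    finally show ?thesis
      using g by (simp add: mult_commutator_left dual_diff)
  qed
  have "one_cocycle fscale D (commutator (\<star>)) fscale (tensor2_space fscale D) (L_ad fscale D (\<star>)) \<beta>"
    unfolding one_cocycle_def linear_on_def
  proof (intro conjI ballI allI)
    show "\<beta> ` D \<subseteq> tensor2_space fscale D" using \<beta>_space by blast
  next
    fix f g assume "f \<in> D" "g \<in> D"
    then show "\<beta> (f + g) = \<beta> f + \<beta> g"
      using E(2) by (intro dual_tensor_eqI)
        (auto simp: \<beta>_space \<beta>_pairing D_add tensor2_space_add tensor_pairing_add)
  next
    fix c f assume "f \<in> D"
    then show "\<beta> (fscale c f) = fscale c (\<beta> f)"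
      unfolding \<beta>_def fscale_sum
      by (intro sum.cong refl)
        (simp add: fscale_def[of c f] E(2) D_mult_left flip: tensor2_scale_right,
          simp add: fscale_def)
  next
    fix f g assume fg: "f \<in> D" "g \<in> D"
    \<comment> \<open>In additive form both sides lie in the tensor space by closure under sums.
      After pairing, the terms symmetric in \<open>f\<close> and \<open>g\<close> agree, and the
      rest is the bracket formula at \<open>mult x y\<close>.\<close>
    have "\<beta> (commutator (\<star>) f g) + L_ad fscale D (\<star>) g (\<beta> f) = L_ad fscale D (\<star>) f (\<beta> g)"
      using fg star.commutator_closed[OF fg] by (intro dual_tensor_eqI tensor2_space_add)
        (simp_all add: \<beta>_space L_ad_space tensor_pairing_add L_ad_pairing \<beta>_pairing
          commutator_star_apply)
    then show "\<beta> (commutator (\<star>) f g) = L_ad fscale D (\<star>) f (\<beta> g) - L_ad fscale D (\<star>) g (\<beta> f)"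
      by (simp add: algebra_simps)
  qed
  with \<beta>_pairing show ?thesis by blast
qed

section \<open>The bialgebra structure\<close>

lemma star_bialgebra: "left_symmetric_bialgebra scale mult (\<star>)"
  unfolding left_symmetric_bialgebra_def
\<comment> \<open>With \<open>\<delta>\<close> as the witness, the duality equation is the
  definition of \<open>\<star>\<close>.\<close>
proof (intro conjI exI[of _ \<delta>])
  show "left_symmetric_algebra scale UNIV mult" by (rule left_symmetric_algebra_axioms)
  show "one_cocycle scale UNIV br fscale (tensor2_space scale UNIV) (L_ad scale UNIV mult) \<delta>"
    unfolding \<delta>_def by (rule one_cocycle_coboundary) auto
qed (auto simp: star_algebra dual_comultiplication dual_product_def dual_map_def)

end

theorem proposition6p1:
  fixes scale :: "'k::field \<Rightarrow> 'a::ab_group_add \<Rightarrow> 'a"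
    and mult :: "'a \<Rightarrow> 'a \<Rightarrow> 'a"
    and I :: "'i set" and a b :: "'i \<Rightarrow> 'a"
    and r :: "('a \<Rightarrow> 'a \<Rightarrow> 'k) \<Rightarrow> 'k"
    and \<alpha> :: "'a \<Rightarrow> ('a \<Rightarrow> 'a \<Rightarrow> 'k) \<Rightarrow> 'k"
  assumes "left_symmetric_algebra scale UNIV mult"
    and "finite I"
    and "r = (\<Sum>i\<in>I. tensor2 scale UNIV (a i) (b i))"
    and "(\<Sum>i\<in>I. tensor2 scale UNIV (a i) (b i)) = (\<Sum>i\<in>I. tensor2 scale UNIV (b i) (a i))"
    and "S_equation scale UNIV mult I a b"
    and "\<And>x. \<alpha> x = L_ad scale UNIV mult x r"
  shows "left_symmetric_algebra fscale (dual scale) (dual_product scale \<alpha>) \<and>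
    left_symmetric_bialgebra scale mult (dual_product scale \<alpha>)"
proof -
  interpret symmetric_S_solution scale mult I a b
    using assms by (simp add: symmetric_S_solution_def symmetric_S_solution_axioms_def)
  have "\<alpha> = \<delta>"
    by (rule ext) (simp only: assms(3,6) \<delta>_def)
  then show ?thesis
    using star_algebra star_bialgebra by simp
qed

end
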